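(* Let $\eta:[0,\pi/2]\to[0,1]$ be any real function, and for $\theta\in\Theta=[0,\pi/2]$ let $\mathcal{E}_\theta(\rho)=E_0\rho E_0^\dagger+E_1\rho E_1^\dagger$ with $E=\begin{pmatrix}\cos\theta&\sin\theta\\-\sin\theta&\cos\theta\end{pmatrix}$, $E_0=\sqrt{\eta_\theta}\,E$, $E_1=\sqrt{1-\eta_\theta}\,ZE$, $Z=\mathrm{diag}(1,-1)$. Then there is an estimation protocol which uses $\mathcal{E}_\theta$ a total of $N$ times and outputs an estimator $\hat\theta$ whose root mean squared error $\sqrt{E(\hat\theta-\theta)^2}$ is $O(\log N/N)$, uniformly in $\theta\in\Theta$.
   Context: An estimation protocol may prepare arbitrary $\theta$-independent (possibly entangled) input states, apply the channel $\mathcal{E}_\theta$ to subsystems in parallel and/or sequence, interleave $\theta$-independent operations, measure, and compute an estimate from the classical outcomes; $N$ counts the total number of uses of $\mathcal{E}_\theta$. *)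

theory Defs
  imports "Jordan_Normal_Form.Schur_Decomposition"
begin

definition ctrace :: "complex mat \<Rightarrow> complex" where
  "ctrace A = (\<Sum>i<dim_row A. A $$ (i, i))"

definition kron :: "complex mat \<Rightarrow> complex mat \<Rightarrow> complex mat" where
  "kron A B = mat (dim_row A * dim_row B) (dim_col A * dim_col B)
     (\<lambda>(i, j). A $$ (i div dim_row B, j div dim_col B) * B $$ (i mod dim_row B, j mod dim_col B))"

definition psd :: "nat \<Rightarrow> complex mat \<Rightarrow> bool" where
  "psd n A \<longleftrightarrow> A \<in> carrier_mat n n \<and> mat_adjoint A = A \<and>
     (\<forall>v \<in> carrier_vec n. 0 \<le> Re (conjugate v \<bullet> (A *\<^sub>v v)))"

definition density :: "nat \<Rightarrow> complex mat \<Rightarrow> bool" where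
  "density n \<rho> \<longleftrightarrow> psd n \<rho> \<and> ctrace \<rho> = 1"

definition msum :: "nat \<Rightarrow> complex mat list \<Rightarrow> complex mat" where
  "msum n As = foldr (+) As (0\<^sub>m n n)"

definition apply_kraus :: "complex mat list \<Rightarrow> complex mat \<Rightarrow> complex mat" where
  "apply_kraus Ks \<rho> = msum (dim_row \<rho>) (map (\<lambda>K. K * \<rho> * mat_adjoint K) Ks)"

definition is_channel :: "nat \<Rightarrow> complex mat list \<Rightarrow> bool" where
  "is_channel n Ks \<longleftrightarrow> (\<forall>K \<in> set Ks. K \<in> carrier_mat n n) \<and>
     msum n (map (\<lambda>K. mat_adjoint K * K) Ks) = 1\<^sub>m n"

definition is_povm :: "nat \<Rightarrow> complex mat list \<Rightarrow> bool" where
  "is_povm n Ms \<longleftrightarrow> (\<forall>M \<in> set Ms. psd n M) \<and> msum n Ms = 1\<^sub>m n"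

definition Emat :: "real \<Rightarrow> complex mat" where
  "Emat \<theta> = mat_of_rows_list 2
     [[complex_of_real (cos \<theta>), complex_of_real (sin \<theta>)],
      [complex_of_real (- sin \<theta>), complex_of_real (cos \<theta>)]]"

definition Zmat :: "complex mat" where
  "Zmat = mat_of_rows_list 2 [[1, 0], [0, -1]]"

definition kraus_E :: "(real \<Rightarrow> real) \<Rightarrow> real \<Rightarrow> complex mat list" where
  "kraus_E \<eta> \<theta> = [complex_of_real (sqrt (\<eta> \<theta>)) \<cdot>\<^sub>m Emat \<theta>,
                    complex_of_real (sqrt (1 - \<eta> \<theta>)) \<cdot>\<^sub>m (Zmat * Emat \<theta>)]"

text \<open>General (sequential, with ancilla of dimension d) protocol: starting from rho0 on
  C^2 (x) C^d, each step applies E_theta (x) id_d followed by a theta-independent channel V_k on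
  the whole system. The number of uses of E_theta is length Vs.\<close>
definition run :: "(real \<Rightarrow> real) \<Rightarrow> real \<Rightarrow> nat \<Rightarrow> complex mat \<Rightarrow> complex mat list list \<Rightarrow> complex mat" where
  "run \<eta> \<theta> d \<rho>0 Vs =
     foldl (\<lambda>\<rho> V. apply_kraus V (apply_kraus (map (\<lambda>K. kron K (1\<^sub>m d)) (kraus_E \<eta> \<theta>)) \<rho>)) \<rho>0 Vs"

definition valid_protocol :: "nat \<Rightarrow> nat \<Rightarrow> complex mat \<Rightarrow> complex mat list list \<Rightarrow> complex mat list \<Rightarrow> bool" where
  "valid_protocol N d \<rho>0 Vs Ms \<longleftrightarrow> 1 \<le> d \<and> density (2 * d) \<rho>0 \<and> length Vs = N \<and>
     (\<forall>V \<in> set Vs. is_channel (2 * d) V) \<and> is_povm (2 * d) Ms"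

definition mse :: "(real \<Rightarrow> real) \<Rightarrow> real \<Rightarrow> nat \<Rightarrow> complex mat \<Rightarrow> complex mat list list \<Rightarrow> complex mat list \<Rightarrow> (nat \<Rightarrow> real) \<Rightarrow> real" where
  "mse \<eta> \<theta> d \<rho>0 Vs Ms est =
     (\<Sum>i<length Ms. Re (ctrace (Ms ! i * run \<eta> \<theta> d \<rho>0 Vs)) * (est i - \<theta>)\<^sup>2)"

end

(* The eigenvectors y(+-) = (1, +-i)/sqrt 2 of the rotation E have eigenvalues exp(+-i theta) and
   are swapped by Z.  Attach an ancilla with levels k = 0..N and, before use n (from 0) of the channel, keep
   the first qubit in y(+) on the levels k > n and in y(-) on the others.  A Z error is
   then the statement that the qubit has the wrong eigenvector for its level, so it can be detected
   and undone without disturbing the superposition of levels, whatever eta is, and the next sign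
   pattern can be installed at the same time.  After N uses the level k has acquired the
   phase exp(i (2k - N) theta), without noise.

   The rest is covariant phase estimation of 2 theta in [0, pi].  With amplitudes a(k)
   proportional to sin(k pi/d), d = N + 1, and the Fourier measurement, multiplying
   the outcome amplitude by 1 - z, which is 2 |sin (error)| in modulus, is a summation by parts, so
   by Parseval the mean of 4 sin^2(error) is the sum of (a(k+1) - a(k))^2, that is
   2 (1 - cos (pi/d)) <= (pi/d)^2.  This even gives a root mean squared error O(1/N). *)

theory Submission
  imports Defs
begin

section \<open>Phase estimation with a sine-shaped amplitude\<close>

lemma mult_cos_le_sin:
  fixes x :: real
  assumes "0 \<le> x" "x \<le> pi"
  shows "x * cos x \<le> sin x"
proof -
  have "(\<lambda>x. sin x - x * cos x) 0 \<le> (\<lambda>x. sin x - x * cos x) x"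
  proof (rule DERIV_nonneg_imp_nondecreasing[where f = "\<lambda>x. sin x - x * cos x"])
    fix t assume t: "0 \<le> t" "t \<le> x"
    have "((\<lambda>x. sin x - x * cos x) has_real_derivative t * sin t) (at t)"
      by (auto intro!: derivative_eq_intros)
    moreover have "0 \<le> t * sin t" using t assms by (intro mult_nonneg_nonneg sin_ge_zero) auto
    ultimately show "\<exists>y. ((\<lambda>x. sin x - x * cos x) has_real_derivative y) (at t) \<and> 0 \<le> y"
      by blast
  qed (use assms in auto)
  thus ?thesis by simp
qed

text \<open>With \<open>c = cos (3 * pi / 8)\<close> this is the inverse fourth power of
  \<open>c\<close>; the half angles that occur are at most \<open>3 * pi / 8\<close>, so their
  cosine is at least \<open>c\<close>.\<close>

definition sin_const :: real where "sin_const = (1 / (cos (3 * pi / 8))\<^sup>2)\<^sup>2"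

text \<open>The bound \<open>x * cos x \<le> sin x\<close> is useless past pi/2, where the cosine is
  negative. It is applied to the half angle \<open>y\<close> instead, and both factors of
  \<open>sin y * cos y\<close> are bounded below through \<open>c\<close>.\<close>

lemma sq_le_sin_sq:
  fixes x :: real
  assumes "\<bar>x\<bar> \<le> 3 * pi / 4"
  shows "x\<^sup>2 \<le> sin_const * (sin x)\<^sup>2"
proof -
  define y where "y = \<bar>x\<bar> / 2"
  define c where "c = cos (3 * pi / 8)"
  have y: "0 \<le> y" "y \<le> 3 * pi / 8" using assms by (auto simp: y_def)
  have c: "0 < c" unfolding c_def by (rule cos_gt_zero_pi) (use pi_gt_zero in linarith)+
  have cy: "c \<le> cos y" unfolding c_def using y pi_gt_zero by (intro cos_monotone_0_pi_le) auto
  have "y * c \<le> y * cos y" using cy y by (intro mult_left_mono)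
  also have "\<dots> \<le> sin y" using y pi_gt_zero by (intro mult_cos_le_sin) auto
  finally have "y * c \<le> sin y" .
  moreover have "0 \<le> y * c" using c y by simp
  ultimately have "y * c * c \<le> sin y * cos y"
    using cy c by (intro mult_mono) linarith+
  hence "2 * y * c\<^sup>2 \<le> sin (2 * y)"
    unfolding sin_double by (simp add: power2_eq_square mult.assoc)
  moreover have "2 * y = \<bar>x\<bar>" by (simp add: y_def)
  ultimately have "\<bar>x\<bar> * c\<^sup>2 \<le> sin \<bar>x\<bar>" by metis
  hence "\<bar>x\<bar> \<le> 1 / c\<^sup>2 * sin \<bar>x\<bar>" using c by (simp add: pos_le_divide_eq)
  hence "\<bar>x\<bar>\<^sup>2 \<le> (1 / c\<^sup>2 * sin \<bar>x\<bar>)\<^sup>2" by (intro power_mono) auto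
  also have "\<dots> = sin_const * (sin x)\<^sup>2"
    unfolding power_mult_distrib by (simp add: sin_const_def c_def abs_if)
  finally show ?thesis by simp
qed

section \<open>Summation by parts, orthogonality of characters and Parseval\<close>

lemma cmod_cis_sub_one: "(cmod (1 - cis x))\<^sup>2 = 4 * (sin (x / 2))\<^sup>2"
proof -
  have "(cmod (1 - cis x))\<^sup>2 = (1 - cos x)\<^sup>2 + (sin x)\<^sup>2"
    by (simp add: cmod_power2)
  also have "\<dots> = 2 - 2 * cos x"
    using sin_cos_squared_add[of x] by (simp add: power2_eq_square algebra_simps)
  also have "cos x = 1 - 2 * (sin (x / 2))\<^sup>2" using cos_double_sin[of "x / 2"] by simp
  finally show ?thesis by simp
qed

text \<open>The vanishing end values allow an index shift without boundary terms. No root of unity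
  is assumed for \<open>z\<close>, which matters because theta is arbitrary.\<close>

lemma sum_by_parts_power:
  fixes z :: complex and a :: "nat \<Rightarrow> complex"
  assumes "a 0 = 0" "a d = 0"
  shows "(1 - z) * (\<Sum>k<d. a k * z ^ k) = z * (\<Sum>k<d. (a (Suc k) - a k) * z ^ k)"
proof -
  have "(\<Sum>k<d. a k * z ^ k) = (\<Sum>k<Suc d. a k * z ^ k)" using assms by simp
  also have "\<dots> = (\<Sum>k<d. a (Suc k) * z ^ Suc k)"
    unfolding sum.lessThan_Suc_shift using assms by simp
  finally have "(\<Sum>k<d. a k * z ^ k) = (\<Sum>k<d. a (Suc k) * z ^ Suc k)" .
  thus ?thesis by (simp add: algebra_simps sum_subtractf sum_distrib_left)
qed

text \<open>The summands are the powers of a \<open>d\<close>-th root of unity \<open>w\<close>, and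
  \<open>w = 1\<close> would make \<open>d\<close> divide \<open>k - l\<close>, impossible for
  distinct indices below \<open>d\<close>. This serves Parseval and the completeness of the
  measurement.\<close>

lemma sum_root_of_unity:
  assumes "k < d" "l < d"
  shows "(\<Sum>m<d. cis (2 * pi * real m * real k / real d) * cnj (cis (2 * pi * real m * real l / real d)))
    = (if k = l then of_nat d else 0)"
proof -
  define w where "w = cis (2 * pi * (real k - real l) / real d)"
  have "cis (2 * pi * real m * real k / real d) * cnj (cis (2 * pi * real m * real l / real d)) = w ^ m" for m
    unfolding w_def DeMoivre cis_cnj cis_mult by (simp add: field_simps diff_divide_distrib)
  moreover have "(\<Sum>m<d. w ^ m) = 0" if "k \<noteq> l"
  proof -
    have "w \<noteq> 1"
    proof
      assume "w = 1"
      hence "cos (2 * pi * (real k - real l) / real d) = 1" by (simp add: w_def complex_eq_iff)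
      then obtain n :: int where "2 * pi * (real k - real l) / real d = real_of_int n * 2 * pi"
        unfolding cos_one_2pi_int by blast
      hence "(2 * pi) * (real k - real l) = (2 * pi) * (real_of_int n * real d)"
        using assms by (simp add: field_simps)
      hence "real k - real l = real_of_int n * real d"
        unfolding mult_cancel_left using pi_gt_zero by simp
      hence "real_of_int (int k - int l) = real_of_int (n * int d)" by simp
      hence "int k - int l = n * int d" by (simp only: of_int_eq_iff)
      hence "int d dvd int k - int l" by simp
      moreover have "\<bar>int k - int l\<bar> < int d" using assms by auto
      ultimately show False using that dvd_imp_le_int[of "int k - int l" "int d"] by auto
    qed
    moreover have "w ^ d = 1"
    proof -
      have "w ^ d = cis (2 * pi * real_of_int (int k - int l))"
        unfolding w_def DeMoivre using assms by simp
      also have "\<dots> = 1" by (rule cis_multiple_2pi) simp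
      finally show ?thesis .
    qed
    ultimately show ?thesis by (simp add: geometric_sum)
  qed
  ultimately show ?thesis by (auto simp: w_def)
qed

text \<open>By the addition theorem the two neighbours of \<open>a k\<close> sum to
  \<open>2 * cos \<phi> * a k\<close>, so the cross terms of the expanded squares become a multiple
  of the squared norm.\<close>

lemma sum_diff_sq_sin:
  fixes a :: "nat \<Rightarrow> real" and \<phi> c :: real
  assumes a: "\<And>k. a k = c * sin (real k * \<phi>)" and "a d = 0"
  shows "(\<Sum>k<d. (a (Suc k) - a k)\<^sup>2) = 2 * (1 - cos \<phi>) * (\<Sum>k<d. (a k)\<^sup>2)"
proof -
  have a0: "a 0 = 0" by (simp add: a)
  \<comment> \<open>At \<open>k = 0\<close> the truncated \<open>k - 1\<close> is \<open>0\<close>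
    again; that term vanishes because \<open>a 0 = 0\<close>.\<close>
  have "(\<Sum>k<Suc d. a k * a (k - 1)) = (\<Sum>k<d. a (Suc k) * a k)"
    unfolding sum.lessThan_Suc_shift by (simp add: a0)
  hence 1: "(\<Sum>k<d. a k * a (k - 1)) = (\<Sum>k<d. a (Suc k) * a k)" using assms(2) by simp
  have "(\<Sum>k<Suc d. (a k)\<^sup>2) = (\<Sum>k<d. (a (Suc k))\<^sup>2)"
    unfolding sum.lessThan_Suc_shift by (simp add: a0)
  hence 2: "(\<Sum>k<d. (a (Suc k))\<^sup>2) = (\<Sum>k<d. (a k)\<^sup>2)" using assms(2) by simp
  have 3: "a k * a (Suc k) + a k * a (k - 1) = 2 * cos \<phi> * (a k)\<^sup>2" for k
  proof (cases k)
    case (Suc n)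
    have e1: "sin (real (Suc k) * \<phi>) = sin (real k * \<phi> + \<phi>)" by (simp add: algebra_simps)
    have e2: "sin (real (k - 1) * \<phi>) = sin (real k * \<phi> - \<phi>)" using Suc by (simp add: algebra_simps)
    show ?thesis unfolding a e1 e2 sin_add sin_diff by (simp add: algebra_simps power2_eq_square)
  qed (simp add: a)
  have "2 * (\<Sum>k<d. a (Suc k) * a k) = (\<Sum>k<d. a k * a (Suc k) + a k * a (k - 1))"
    using 1 by (simp add: sum.distrib mult.commute)
  also have "\<dots> = 2 * cos \<phi> * (\<Sum>k<d. (a k)\<^sup>2)" unfolding 3 by (simp add: sum_distrib_left)
  finally have 4: "2 * (\<Sum>k<d. a (Suc k) * a k) = 2 * cos \<phi> * (\<Sum>k<d. (a k)\<^sup>2)" .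
  have "(\<Sum>k<d. (a (Suc k) - a k)\<^sup>2)
      = (\<Sum>k<d. (a (Suc k))\<^sup>2) + (\<Sum>k<d. (a k)\<^sup>2) - 2 * (\<Sum>k<d. a (Suc k) * a k)"
    by (simp add: power2_diff sum.distrib sum_subtractf sum_distrib_left mult.assoc)
  thus ?thesis unfolding 2 4 by (simp add: algebra_simps)
qed

lemma one_minus_cos_le: "1 - cos x \<le> x\<^sup>2 / (2::real)"
proof -
  have "1 - cos x = 2 * (sin (x / 2))\<^sup>2" using cos_double_sin[of "x / 2"] by simp
  also have "(sin (x / 2))\<^sup>2 \<le> (x / 2)\<^sup>2"
    using abs_sin_x_le_abs_x[of "x / 2"] by (simp only: abs_le_square_iff)
  finally show ?thesis by (simp add: power2_eq_square)
qed

text \<open>The columns of \<open>u\<close> are orthonormal, so after expanding the squares and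
  summing over \<open>m\<close> first only the diagonal terms remain.\<close>

lemma Parseval_finite:
  fixes d n :: nat and u :: "nat \<Rightarrow> nat \<Rightarrow> complex"
  assumes "\<And>k l. k < d \<Longrightarrow> l < d \<Longrightarrow>
      (\<Sum>m<n. u m k * cnj (u m l)) = (if k = l then 1 else 0)"
  shows "(\<Sum>m<n. (cmod (\<Sum>k<d. u m k * b k))\<^sup>2) = (\<Sum>k<d. (cmod (b k))\<^sup>2)"
proof -
  have "complex_of_real (\<Sum>m<n. (cmod (\<Sum>k<d. u m k * b k))\<^sup>2)
      = (\<Sum>m<n. \<Sum>k<d. \<Sum>l<d. (u m k * b k) * cnj (u m l * b l))"
    by (simp add: complex_norm_square sum_product del: of_real_power)
  also have "\<dots> = (\<Sum>k<d. \<Sum>m<n. \<Sum>l<d. (u m k * b k) * cnj (u m l * b l))"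
    by (rule sum.swap)
  also have "\<dots> = (\<Sum>k<d. \<Sum>l<d. \<Sum>m<n. (u m k * b k) * cnj (u m l * b l))"
    by (intro sum.cong refl sum.swap)
  also have "\<dots> = (\<Sum>k<d. \<Sum>l<d. (\<Sum>m<n. u m k * cnj (u m l)) * (b k * cnj (b l)))"
    by (simp add: sum_distrib_right sum_distrib_left mult_ac)
  also have "\<dots> = (\<Sum>k<d. \<Sum>l<d. if l = k then b k * cnj (b k) else 0)"
    using assms by (intro sum.cong refl) (auto split: if_splits)
  also have "\<dots> = complex_of_real (\<Sum>k<d. (cmod (b k))\<^sup>2)"
    by (simp only: of_real_sum complex_norm_square) simp
  finally show ?thesis by (simp only: of_real_eq_iff)
qed

section \<open>The estimator and its mean squared error\<close>

text \<open>As \<open>\<theta>\<close> lies in \<open>[0, \<pi>/2]\<close>, choosing the estimate in \<open>[-\<pi>/4, 3\<pi>/4]\<close> keeps the error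
  within \<open>3\<pi>/4\<close>, away from the other zeros \<open>\<plusminus>\<pi>\<close> of the sine.\<close>
definition phase_est :: "nat \<Rightarrow> nat \<Rightarrow> real" where
  "phase_est d m = (let t = pi * real m / real d in if t \<le> 3 * pi / 4 then t else t - pi)"

text \<open>Replacing \<open>t\<close> by \<open>t - pi\<close> only flips the sign of the sine, so
  the square is the same for both candidates, while the choice between them meets the range of
  \<open>sq_le_sin_sq\<close>.\<close>

lemma phase_est_error:
  assumes "m < d" "0 \<le> \<theta>" "\<theta> \<le> pi / 2"
  shows "(phase_est d m - \<theta>)\<^sup>2 \<le> sin_const * (sin (\<theta> - pi * real m / real d))\<^sup>2"
proof -
  define t where "t = pi * real m / real d"
  have t: "0 \<le> t" "t \<le> pi"
    using assms(1) pi_gt_zero by (auto simp: t_def field_simps intro!: mult_left_mono)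
  have "\<bar>phase_est d m - \<theta>\<bar> \<le> 3 * pi / 4"
    using t assms pi_gt_zero unfolding phase_est_def t_def[symmetric] Let_def abs_le_iff by auto
  hence "(phase_est d m - \<theta>)\<^sup>2 \<le> sin_const * (sin (phase_est d m - \<theta>))\<^sup>2"
    by (rule sq_le_sin_sq)
  also have "(sin (phase_est d m - \<theta>))\<^sup>2 = (sin (t - \<theta>))\<^sup>2"
    using sin_minus_pi[of "t - \<theta>"]
    by (auto simp: phase_est_def t_def[symmetric] Let_def algebra_simps)
  also have "\<dots> = (sin (\<theta> - t))\<^sup>2"
    by (metis minus_diff_eq power2_minus sin_minus)
  finally show ?thesis by (simp only: t_def)
qed

lemma sin_const_nonneg: "0 \<le> sin_const"
  by (simp add: sin_const_def)

text \<open>This is the classical half of the argument: the mean squared error under the Fourier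
  outcome distribution, free of any matrix.\<close>

lemma phase_estimation_error:
  fixes a :: "nat \<Rightarrow> real"
  assumes d: "d > 0" and a: "\<And>k. a k = c * sin (real k * (pi / real d))"
    and norm: "(\<Sum>k<d. (a k)\<^sup>2) = 1" and \<theta>: "0 \<le> \<theta>" "\<theta> \<le> pi / 2"
  shows "(\<Sum>m<d. (cmod (\<Sum>k<d. complex_of_real (a k) * cis (2 * \<theta> - 2 * pi * real m / real d) ^ k))\<^sup>2
            / real d * (phase_est d m - \<theta>)\<^sup>2)
    \<le> sin_const / 4 * (pi / real d)\<^sup>2"
proof -
  define z where "z m = cis (2 * \<theta> - 2 * pi * real m / real d)" for m
  \<comment> \<open>The factor \<open>cis (2 * \<theta>) ^ k\<close> has modulus one. Putting it
    into \<open>b\<close> leaves in \<open>u\<close> a unitary Fourier matrix free of theta.\<close>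
  define b where "b k = complex_of_real (a (Suc k) - a k) * cis (2 * \<theta>) ^ k" for k
  define u where "u m k = cnj (cis (2 * pi * real m * real k / real d)) / complex_of_real (sqrt (real d))" for m k
  have ends: "a 0 = 0" "a d = 0" using d by (simp_all add: a)
  have zpow: "z m ^ k = cis (2 * \<theta>) ^ k * cnj (cis (2 * pi * real m * real k / real d))" for m k
    by (simp add: z_def DeMoivre cis_cnj cis_mult algebra_simps)
  have "(cmod (\<Sum>k<d. complex_of_real (a k) * z m ^ k))\<^sup>2 / real d * (phase_est d m - \<theta>)\<^sup>2
      \<le> sin_const / 4 * (cmod (\<Sum>k<d. u m k * b k))\<^sup>2" if m: "m < d" for m
  proof -
    let ?S = "\<Sum>k<d. complex_of_real (a k) * z m ^ k"
    have "(phase_est d m - \<theta>)\<^sup>2 \<le> sin_const * (sin (\<theta> - pi * real m / real d))\<^sup>2"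
      using m \<theta> by (rule phase_est_error)
    \<comment> \<open>Half the argument of \<open>z m\<close> is exactly the angle inside the
      sine.\<close>
    also have "\<dots> = sin_const / 4 * (cmod (1 - z m))\<^sup>2"
      unfolding z_def cmod_cis_sub_one by (simp add: diff_divide_distrib)
    finally have "(cmod ?S)\<^sup>2 / real d * (phase_est d m - \<theta>)\<^sup>2
        \<le> (cmod ?S)\<^sup>2 / real d * (sin_const / 4 * (cmod (1 - z m))\<^sup>2)"
      by (intro mult_left_mono) auto
    also have "\<dots> = sin_const / 4 * ((cmod ((1 - z m) * ?S))\<^sup>2 / real d)"
      by (simp add: norm_mult power_mult_distrib mult_ac)
    also have "(1 - z m) * ?S
        = z m * (\<Sum>k<d. (complex_of_real (a (Suc k)) - complex_of_real (a k)) * z m ^ k)"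
      by (rule sum_by_parts_power) (simp_all add: ends)
    also have "cmod \<dots> = cmod (\<Sum>k<d. (complex_of_real (a (Suc k)) - complex_of_real (a k)) * z m ^ k)"
      by (simp add: norm_mult z_def)
    also have "(\<Sum>k<d. (complex_of_real (a (Suc k)) - complex_of_real (a k)) * z m ^ k)
        = complex_of_real (sqrt (real d)) * (\<Sum>k<d. u m k * b k)"
      using d unfolding sum_distrib_left
      by (intro sum.cong refl) (simp add: zpow u_def b_def)
    also have "(cmod \<dots>)\<^sup>2 / real d = (cmod (\<Sum>k<d. u m k * b k))\<^sup>2"
      using d by (simp add: norm_mult power_mult_distrib)
    finally show ?thesis .
  qed
  hence "(\<Sum>m<d. (cmod (\<Sum>k<d. complex_of_real (a k) * z m ^ k))\<^sup>2 / real d * (phase_est d m - \<theta>)\<^sup>2)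
      \<le> (\<Sum>m<d. sin_const / 4 * (cmod (\<Sum>k<d. u m k * b k))\<^sup>2)"
    by (intro sum_mono) auto
  also have "\<dots> = sin_const / 4 * (\<Sum>k<d. (cmod (b k))\<^sup>2)"
  proof -
    have "(\<Sum>m<d. u m k * cnj (u m l)) = (if k = l then 1 else 0)" if "k < d" "l < d" for k l
    proof -
      have "u m k * cnj (u m l) = cis (2 * pi * real m * real l / real d)
          * cnj (cis (2 * pi * real m * real k / real d)) / of_nat d" for m
        using d by (simp add: u_def mult.commute flip: of_real_mult)
      \<comment> \<open>The characters in \<open>u\<close> are conjugated, hence the exchanged roles
        of \<open>k\<close> and \<open>l\<close>.\<close>
      thus ?thesis using sum_root_of_unity[OF that(2,1)] d
        by (simp flip: sum_divide_distrib)
    qed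
    thus ?thesis unfolding sum_distrib_left[symmetric] by (subst Parseval_finite) simp_all
  qed
  also have "(\<Sum>k<d. (cmod (b k))\<^sup>2) = (\<Sum>k<d. (a (Suc k) - a k)\<^sup>2)"
    unfolding b_def norm_mult norm_power norm_of_real norm_cis by simp
  also have "\<dots> = 2 * (1 - cos (pi / real d))"
    using sum_diff_sq_sin[OF a ends(2)] norm by simp
  also have "sin_const / 4 * \<dots> \<le> sin_const / 4 * (pi / real d)\<^sup>2"
    using one_minus_cos_le[of "pi / real d"] sin_const_nonneg by (intro mult_left_mono) auto
  finally show ?thesis by (simp only: z_def)
qed

section \<open>Rank-one and block matrices\<close>

definition outer :: "nat \<Rightarrow> (nat \<Rightarrow> complex) \<Rightarrow> complex mat" where
  "outer n f = mat n n (\<lambda>(i, j). f i * cnj (f j))"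

text \<open>In Dirac notation, the sum over k of B(k) (x) |k><k|: a qubit operator controlled by the
  ancilla level. Noise and recovery both have this form, so they can be computed level by
  level.\<close>

definition block_mat :: "nat \<Rightarrow> (nat \<Rightarrow> nat \<Rightarrow> nat \<Rightarrow> complex) \<Rightarrow> complex mat" where
  "block_mat d B = mat (2 * d) (2 * d)
     (\<lambda>(i, j). if i mod d = j mod d then B (i mod d) (i div d) (j div d) else 0)"

lemma outer_carrier [simp]: "outer n f \<in> carrier_mat n n"
  by (simp add: outer_def)

lemma outer_dim [simp]: "dim_row (outer n f) = n" "dim_col (outer n f) = n"
  by (simp_all add: outer_def)

lemma block_mat_carrier [simp]: "block_mat d B \<in> carrier_mat (2 * d) (2 * d)"
  by (simp add: block_mat_def)

lemma block_mat_dim [simp]: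
  "dim_row (block_mat d B) = 2 * d" "dim_col (block_mat d B) = 2 * d"
  by (simp_all add: block_mat_def)

lemma mat_adjoint_dim [simp]:
  "dim_row (mat_adjoint A) = dim_col A" "dim_col (mat_adjoint A) = dim_row A"
  by (simp_all add: mat_adjoint_def)

lemma mat_adjoint_carrier [simp]: "A \<in> carrier_mat n m \<Longrightarrow> mat_adjoint A \<in> carrier_mat m n"
  by (intro carrier_matI) simp_all

lemma mat_adjoint_index:
  fixes A :: "complex mat"
  shows "i < dim_col A \<Longrightarrow> j < dim_row A \<Longrightarrow> mat_adjoint A $$ (i, j) = cnj (A $$ (j, i))"
  by (simp add: mat_adjoint_def mat_of_rows_index)

lemma mult_index:
  fixes A B :: "complex mat"
  assumes "A \<in> carrier_mat n m" "B \<in> carrier_mat m l" "i < n" "j < l"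
  shows "(A * B) $$ (i, j) = (\<Sum>k<m. A $$ (i, k) * B $$ (k, j))"
  using assms by (auto simp: scalar_prod_def atLeast0LessThan)

text \<open>Lets Kraus operators be followed on state vectors: conjugating a rank-one matrix amounts
  to applying \<open>A\<close> to \<open>f\<close>.\<close>

lemma conj_outer:
  assumes "A \<in> carrier_mat n n"
  shows "A * outer n f * mat_adjoint A = outer n (\<lambda>i. \<Sum>j<n. A $$ (i, j) * f j)"
proof (rule eq_matI)
  fix i j assume "i < dim_row (outer n (\<lambda>i. \<Sum>j<n. A $$ (i, j) * f j))"
    "j < dim_col (outer n (\<lambda>i. \<Sum>j<n. A $$ (i, j) * f j))"
  hence ij: "i < n" "j < n" by simp_all
  have 1: "(A * outer n f) $$ (i, k) = (\<Sum>l<n. A $$ (i, l) * f l) * cnj (f k)" if "k < n" for k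
    using assms ij that
    by (subst mult_index[where n = n and m = n and l = n])
       (auto simp: outer_def sum_distrib_right mult.assoc)
  have "(A * outer n f * mat_adjoint A) $$ (i, j)
      = (\<Sum>k<n. (A * outer n f) $$ (i, k) * mat_adjoint A $$ (k, j))"
    using assms ij by (intro mult_index[where n = n and l = n]) auto
  also have "\<dots> = (\<Sum>k<n. (\<Sum>l<n. A $$ (i, l) * f l) * cnj (A $$ (j, k) * f k))"
    using assms ij by (intro sum.cong) (simp_all add: 1 mat_adjoint_index del: index_mult_mat)
  also have "\<dots> = outer n (\<lambda>i. \<Sum>j<n. A $$ (i, j) * f j) $$ (i, j)"
    using ij by (simp add: outer_def sum_distrib_left)
  finally show "(A * outer n f * mat_adjoint A) $$ (i, j)
      = outer n (\<lambda>i. \<Sum>j<n. A $$ (i, j) * f j) $$ (i, j)" .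
qed (use assms in auto)

lemma cmod_sq_eq: "z * cnj z = complex_of_real ((cmod z)\<^sup>2)"
  by (simp only: complex_norm_square)

text \<open>The quadratic form is the squared modulus of an inner product with \<open>f\<close>.
  This covers the probe as well as the measurement effects.\<close>

lemma psd_outer: "psd n (outer n f)"
  unfolding psd_def
proof (intro conjI ballI)
  show "mat_adjoint (outer n f) = outer n f"
    by (rule eq_matI) (auto simp: mat_adjoint_index, auto simp: outer_def)
  fix v :: "complex vec" assume v: "v \<in> carrier_vec n"
  have "conjugate v \<bullet> (outer n f *\<^sub>v v)
      = (\<Sum>i<n. cnj (v $ i) * (\<Sum>j<n. f i * cnj (f j) * v $ j))"
    using v by (auto simp: scalar_prod_def atLeast0LessThan outer_def intro!: sum.cong)
  also have "\<dots> = (\<Sum>i<n. \<Sum>j<n. (cnj (v $ i) * f i) * cnj (cnj (v $ j) * f j))"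
    by (simp add: sum_distrib_left mult_ac)
  also have "\<dots> = (\<Sum>i<n. cnj (v $ i) * f i) * cnj (\<Sum>i<n. cnj (v $ i) * f i)"
    by (simp only: sum_product cnj_sum)
  finally show "0 \<le> Re (conjugate v \<bullet> (outer n f *\<^sub>v v))"
    by (simp only: cmod_sq_eq) simp
qed simp

lemma ctrace_outer: "ctrace (outer n f) = (\<Sum>i<n. complex_of_real ((cmod (f i))\<^sup>2))"
  by (simp add: ctrace_def outer_def cmod_sq_eq)

text \<open>The Born rule for a pure state and a rank-one effect.\<close>

lemma ctrace_outer_outer:
  "ctrace (outer n f * outer n g) = complex_of_real ((cmod (\<Sum>i<n. cnj (f i) * g i))\<^sup>2)"
proof -
  have "ctrace (outer n f * outer n g)
      = (\<Sum>i<n. \<Sum>j<n. (f i * cnj (f j)) * (g j * cnj (g i)))"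
    unfolding ctrace_def
    by (rule sum.cong, simp, subst mult_index[where n = n and m = n and l = n])
       (auto simp: outer_def)
  also have "\<dots> = (\<Sum>i<n. cnj (f i) * g i) * cnj (\<Sum>i<n. cnj (f i) * g i)"
    by (subst mult.commute) (simp add: sum_product mult_ac)
  finally show ?thesis by (simp only: cmod_sq_eq)
qed

lemma sum_two_mult:
  fixes f :: "nat \<Rightarrow> 'a::comm_monoid_add"
  shows "(\<Sum>i<2 * d. f i) = (\<Sum>q<2. \<Sum>k<d. f (q * d + k))"
proof -
  have "(\<Sum>i<2 * d. f i) = (\<Sum>i\<in>{..<d} \<union> {d..<2 * d}. f i)"
    by (rule sum.cong) auto
  also have "\<dots> = (\<Sum>i<d. f i) + (\<Sum>i\<in>{d..<2 * d}. f i)"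
    by (rule sum.union_disjoint) auto
  also have "(\<Sum>i\<in>{d..<2 * d}. f i) = (\<Sum>k<d. f (d + k))"
    using sum.shift_bounds_nat_ivl[of f 0 d d]
    by (simp add: atLeast0LessThan mult_2 add.commute)
  finally show ?thesis by (simp add: numeral_2_eq_2)
qed

text \<open>In row \<open>i\<close> only the two columns with the level of \<open>i\<close>
  survive.\<close>

lemma block_mat_mult_fun:
  assumes "i < 2 * d"
  shows "(\<Sum>j<2 * d. block_mat d B $$ (i, j) * g (j div d) (j mod d))
    = (\<Sum>q<2. B (i mod d) (i div d) q * g q (i mod d))"
proof -
  have d: "d > 0" using assms by auto
  have "(\<Sum>j<2 * d. block_mat d B $$ (i, j) * g (j div d) (j mod d))
     = (\<Sum>q<2. \<Sum>k<d. block_mat d B $$ (i, q * d + k) * g ((q * d + k) div d) ((q * d + k) mod d))"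
    by (rule sum_two_mult)
  also have "\<dots> = (\<Sum>q<2. \<Sum>k<d. if k = i mod d then B (i mod d) (i div d) q * g q k else 0)"
  proof (intro sum.cong refl)
    fix q k :: nat assume "q \<in> {..<2}" "k \<in> {..<d}"
    moreover from this have "q * d + k < 2 * d" by (cases "q = 0") (auto simp: less_2_cases_iff)
    ultimately show "block_mat d B $$ (i, q * d + k) * g ((q * d + k) div d) ((q * d + k) mod d)
        = (if k = i mod d then B (i mod d) (i div d) q * g q k else 0)"
      using assms by (auto simp: block_mat_def)
  qed
  also have "\<dots> = (\<Sum>q<2. B (i mod d) (i div d) q * g q (i mod d))"
    using d by simp
  finally show ?thesis .
qed

lemma outer_cong: "(\<And>i. i < n \<Longrightarrow> f i = g i) \<Longrightarrow> outer n f = outer n g"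
  by (auto simp: outer_def intro!: cong_mat)

lemma conj_block_outer:
  "block_mat d B * outer (2 * d) (\<lambda>i. g (i div d) (i mod d)) * mat_adjoint (block_mat d B)
    = outer (2 * d) (\<lambda>i. \<Sum>q<2. B (i mod d) (i div d) q * g q (i mod d))"
  unfolding conj_outer[OF block_mat_carrier] by (intro outer_cong block_mat_mult_fun)

lemma adjoint_block_mult_block:
  "mat_adjoint (block_mat d A) * block_mat d B
    = block_mat d (\<lambda>k q r. \<Sum>p<2. cnj (A k p q) * B k p r)"
proof (rule eq_matI)
  fix i j assume "i < dim_row (block_mat d (\<lambda>k q r. \<Sum>p<2. cnj (A k p q) * B k p r))"
    "j < dim_col (block_mat d (\<lambda>k q r. \<Sum>p<2. cnj (A k p q) * B k p r))"
  hence ij: "i < 2 * d" "j < 2 * d" by simp_all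
  have "(mat_adjoint (block_mat d A) * block_mat d B) $$ (i, j)
     = (\<Sum>l<2 * d. block_mat d (\<lambda>k q r. cnj (A k r q)) $$ (i, l) *
          (if l mod d = j mod d then B (l mod d) (l div d) (j div d) else 0))"
    using ij by (subst mult_index[where n = "2 * d" and m = "2 * d" and l = "2 * d"])
      (auto intro!: sum.cong simp: mat_adjoint_index, auto simp: block_mat_def)
  also have "\<dots> = (\<Sum>p<2. cnj (A (i mod d) p (i div d)) *
      (if i mod d = j mod d then B (i mod d) p (j div d) else 0))"
    using ij(1) by (rule block_mat_mult_fun)
  finally show "(mat_adjoint (block_mat d A) * block_mat d B) $$ (i, j)
      = block_mat d (\<lambda>k q r. \<Sum>p<2. cnj (A k p q) * B k p r) $$ (i, j)"
    using ij by (auto simp: block_mat_def)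
qed auto

lemma kron_one_eq_block:
  assumes "K \<in> carrier_mat 2 2"
  shows "kron K (1\<^sub>m d) = block_mat d (\<lambda>k q r. K $$ (q, r))"
proof (rule eq_matI)
  fix i j assume "i < dim_row (block_mat d (\<lambda>k q r. K $$ (q, r)))"
    "j < dim_col (block_mat d (\<lambda>k q r. K $$ (q, r)))"
  hence ij: "i < 2 * d" "j < 2 * d" by simp_all
  hence "0 < d" by auto
  hence "i mod d < d" "j mod d < d" by simp_all
  thus "kron K (1\<^sub>m d) $$ (i, j) = block_mat d (\<lambda>k q r. K $$ (q, r)) $$ (i, j)"
    using assms ij by (simp add: kron_def block_mat_def)
qed (use assms in \<open>auto simp: kron_def\<close>)

lemma sum_lessThan_two: "(\<Sum>q<2. f q) = f 0 + f (1::nat)"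
  by (simp add: numeral_2_eq_2)

section \<open>The encoded probe and its recovery\<close>

definition yvec :: "bool \<Rightarrow> nat \<Rightarrow> complex" where
  "yvec s q = (if q = 0 then 1 else if s then \<i> else - \<i>) / complex_of_real (sqrt 2)"

text \<open>Index \<open>i = q * d + k\<close> stands for qubit state \<open>q\<close> and ancilla level \<open>k\<close>; level \<open>k\<close> carries the
  amplitude \<open>c k\<close>.\<close>
definition code :: "nat \<Rightarrow> (nat \<Rightarrow> bool) \<Rightarrow> (nat \<Rightarrow> complex) \<Rightarrow> complex mat" where
  "code d s c = outer (2 * d) (\<lambda>i. c (i mod d) * yvec (s (i mod d)) (i div d))"

definition reset_mat :: "nat \<Rightarrow> (nat \<Rightarrow> bool) \<Rightarrow> (nat \<Rightarrow> bool) \<Rightarrow> complex mat" where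
  "reset_mat d s t = block_mat d (\<lambda>k q r. yvec (t k) q * cnj (yvec (s k) r))"

text \<open>The first Kraus operator acts when no \<open>Z\<close> error happened, the second one undoes an error.\<close>
definition recovery :: "nat \<Rightarrow> (nat \<Rightarrow> bool) \<Rightarrow> (nat \<Rightarrow> bool) \<Rightarrow> complex mat list" where
  "recovery d s t = [reset_mat d s t, reset_mat d (\<lambda>k. \<not> s k) t]"

lemma yvec_orthonormal: "(\<Sum>q<2. cnj (yvec s q) * yvec t q) = (if s = t then 1 else 0)"
  by (cases s; cases t) (simp_all add: sum_lessThan_two yvec_def field_simps flip: of_real_mult)

lemma cmod_yvec_sq: "(cmod (yvec s q))\<^sup>2 = 1 / 2"
  by (simp add: yvec_def norm_divide power_divide)

lemma yvec_complete:
  assumes "q < 2" "r < 2"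
  shows "yvec s q * cnj (yvec s r) + yvec (\<not> s) q * cnj (yvec (\<not> s) r) = (if q = r then 1 else 0)"
  using assms by (cases s) (auto simp: less_2_cases_iff yvec_def field_simps simp flip: of_real_mult)

lemma code_carrier [simp]: "code d s c \<in> carrier_mat (2 * d) (2 * d)"
  by (simp add: code_def)

lemma code_dim [simp]: "dim_row (code d s c) = 2 * d" "dim_col (code d s c) = 2 * d"
  by (simp_all add: code_def)

lemma code_index:
  "i < 2 * d \<Longrightarrow> j < 2 * d \<Longrightarrow> code d s c $$ (i, j)
    = c (i mod d) * cnj (c (j mod d)) *
      (yvec (s (i mod d)) (i div d) * cnj (yvec (s (j mod d)) (j div d)))"
  by (simp add: code_def outer_def)

lemma conj_block_code:
  "block_mat d B * code d s c * mat_adjoint (block_mat d B)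
    = outer (2 * d) (\<lambda>i. c (i mod d) * (\<Sum>q<2. B (i mod d) (i div d) q * yvec (s (i mod d)) q))"
  unfolding code_def conj_block_outer[where g = "\<lambda>q k. c k * yvec (s k) q"]
  by (simp add: sum_distrib_left mult_ac)

lemma conj_reset_code:
  "reset_mat d s t * code d u c * mat_adjoint (reset_mat d s t)
    = code d t (\<lambda>k. if s k = u k then c k else 0)"
proof -
  have "(\<Sum>q<2. yvec (t k) p * cnj (yvec (s k) q) * yvec (u k) q)
      = (if s k = u k then yvec (t k) p else 0)" for k p
    using yvec_orthonormal[of "s k" "u k"]
    by (simp add: mult.assoc flip: sum_distrib_left)
  thus ?thesis unfolding reset_mat_def conj_block_code unfolding code_def
    by (intro outer_cong) simp
qed

lemma Emat_carrier [simp]: "Emat \<theta> \<in> carrier_mat 2 2"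
  by (simp add: Emat_def mat_of_rows_list_def numeral_2_eq_2)

lemma Zmat_carrier [simp]: "Zmat \<in> carrier_mat 2 2"
  by (simp add: Zmat_def mat_of_rows_list_def numeral_2_eq_2)

lemma Emat_yvec:
  assumes "q < 2"
  shows "(\<Sum>r<2. Emat \<theta> $$ (q, r) * yvec s r) = cis (if s then \<theta> else - \<theta>) * yvec s q"
  using assms
  by (auto simp: less_2_cases_iff sum_lessThan_two Emat_def mat_of_rows_list_def yvec_def
      complex_eq_iff field_simps)

lemma ZEmat_yvec:
  assumes "q < 2"
  shows "(\<Sum>r<2. (Zmat * Emat \<theta>) $$ (q, r) * yvec s r)
    = cis (if s then \<theta> else - \<theta>) * yvec (\<not> s) q"
proof -
  have "(Zmat * Emat \<theta>) $$ (q, r) = (if q = 0 then 1 else - 1) * Emat \<theta> $$ (q, r)" if "r < 2" for r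
    using assms that
    by (subst mult_index[where n = 2 and m = 2 and l = 2])
       (auto simp: less_2_cases_iff sum_lessThan_two Zmat_def mat_of_rows_list_def)
  hence "(\<Sum>r<2. (Zmat * Emat \<theta>) $$ (q, r) * yvec s r)
      = (if q = 0 then 1 else - 1) * (\<Sum>r<2. Emat \<theta> $$ (q, r) * yvec s r)"
    by (simp add: sum_lessThan_two del: index_mult_mat)
  also have "\<dots> = cis (if s then \<theta> else - \<theta>) * yvec (\<not> s) q"
    unfolding Emat_yvec[OF assms] by (simp add: yvec_def)
  finally show ?thesis .
qed

lemma conj_kron_code:
  assumes "K \<in> carrier_mat 2 2"
    and "\<And>q k. q < 2 \<Longrightarrow> (\<Sum>r<2. K $$ (q, r) * yvec (s k) r) = g k * yvec (t k) q"
  shows "kron K (1\<^sub>m d) * code d s c * mat_adjoint (kron K (1\<^sub>m d))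
    = code d t (\<lambda>k. c k * g k)"
  unfolding kron_one_eq_block[OF assms(1)] conj_block_code
  unfolding code_def
  by (intro outer_cong) (simp add: assms(2) less_mult_imp_div_less mult.assoc)

lemma apply_kraus_pair:
  assumes "X \<in> carrier_mat n n" "A \<in> carrier_mat n n" "B \<in> carrier_mat n n"
  shows "apply_kraus [A, B] X = A * X * mat_adjoint A + B * X * mat_adjoint B"
proof -
  have "B * X * mat_adjoint B \<in> carrier_mat n n"
    using assms by (metis mat_adjoint_carrier mult_carrier_mat)
  thus ?thesis using assms by (simp add: apply_kraus_def msum_def)
qed

lemma conj_add:
  fixes A X Y :: "complex mat"
  assumes "X \<in> carrier_mat n n" "Y \<in> carrier_mat n n" "A \<in> carrier_mat n n"
  shows "A * (X + Y) * mat_adjoint A = A * X * mat_adjoint A + A * Y * mat_adjoint A"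
  by (simp only: mult_add_distrib_mat[OF assms(3,1,2)]
      add_mult_distrib_mat[OF mult_carrier_mat[OF assms(3,1)] mult_carrier_mat[OF assms(3,2)]
        mat_adjoint_carrier[OF assms(3)]])

lemma kron_carrier:
  "K \<in> carrier_mat 2 2 \<Longrightarrow> kron K (1\<^sub>m d) \<in> carrier_mat (2 * d) (2 * d)"
  by (simp add: kron_one_eq_block)

lemma reset_mat_carrier [simp]: "reset_mat d s t \<in> carrier_mat (2 * d) (2 * d)"
  by (simp add: reset_mat_def)

lemma apply_noise_code:
  "apply_kraus (map (\<lambda>K. kron K (1\<^sub>m d)) (kraus_E \<eta> \<theta>)) (code d s c)
    = code d s (\<lambda>k. c k * (complex_of_real (sqrt (\<eta> \<theta>)) * cis (if s k then \<theta> else - \<theta>)))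
    + code d (\<lambda>k. \<not> s k) (\<lambda>k. c k * (complex_of_real (sqrt (1 - \<eta> \<theta>)) * cis (if s k then \<theta> else - \<theta>)))"
proof -
  define a b where "a = complex_of_real (sqrt (\<eta> \<theta>))" and "b = complex_of_real (sqrt (1 - \<eta> \<theta>))"
  have [simp]: "Zmat * Emat \<theta> \<in> carrier_mat 2 2" by (rule mult_carrier_mat[where n = 2]) simp_all
  have C: "a \<cdot>\<^sub>m Emat \<theta> \<in> carrier_mat 2 2" "b \<cdot>\<^sub>m (Zmat * Emat \<theta>) \<in> carrier_mat 2 2"
    by (rule smult_carrier_mat, simp)+
  have dims: "dim_row (Emat \<theta>) = 2" "dim_col (Emat \<theta>) = 2"
    "dim_row (Zmat * Emat \<theta>) = 2" "dim_col (Zmat * Emat \<theta>) = 2"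
    using carrier_matD[OF Emat_carrier[of \<theta>]] carrier_matD[OF Zmat_carrier] by simp_all
  have "(\<Sum>r<2. (a \<cdot>\<^sub>m Emat \<theta>) $$ (q, r) * yvec u r) = a * (\<Sum>r<2. Emat \<theta> $$ (q, r) * yvec u r)"
    if "q < 2" for q u
    using that dims by (simp add: sum_distrib_left mult.assoc)
  hence E: "(\<Sum>r<2. (a \<cdot>\<^sub>m Emat \<theta>) $$ (q, r) * yvec u r)
      = (a * cis (if u then \<theta> else - \<theta>)) * yvec u q" if "q < 2" for q u
    using that by (simp only: Emat_yvec mult.assoc)
  have "(\<Sum>r<2. (b \<cdot>\<^sub>m (Zmat * Emat \<theta>)) $$ (q, r) * yvec u r)
      = b * (\<Sum>r<2. (Zmat * Emat \<theta>) $$ (q, r) * yvec u r)" if "q < 2" for q u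
    using that dims by (simp add: sum_distrib_left mult.assoc del: index_mult_mat)
  hence Z: "(\<Sum>r<2. (b \<cdot>\<^sub>m (Zmat * Emat \<theta>)) $$ (q, r) * yvec u r)
      = (b * cis (if u then \<theta> else - \<theta>)) * yvec (\<not> u) q" if "q < 2" for q u
    using that by (simp only: ZEmat_yvec mult.assoc)
  show ?thesis
    unfolding kraus_E_def list.map a_def[symmetric] b_def[symmetric]
    by (subst apply_kraus_pair[OF code_carrier C[THEN kron_carrier]])
       (simp only: conj_kron_code[OF C(1) E] conj_kron_code[OF C(2) Z])
qed

lemma apply_recovery_code:
  assumes "\<alpha>\<^sup>2 + \<beta>\<^sup>2 = 1"
  shows "apply_kraus (recovery d s t)
      (code d s (\<lambda>k. complex_of_real \<alpha> * c k) + code d (\<lambda>k. \<not> s k) (\<lambda>k. complex_of_real \<beta> * c k))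
    = code d t c"
proof -
  have "complex_of_real \<alpha> * \<alpha> + complex_of_real \<beta> * \<beta> = 1"
    using assms by (simp add: power2_eq_square flip: of_real_mult of_real_add)
  hence *: "complex_of_real \<alpha> * (\<alpha> * x) + complex_of_real \<beta> * (\<beta> * x) = x" for x :: complex
    by (simp flip: mult.assoc distrib_right)
  have "apply_kraus (recovery d s t)
      (code d s (\<lambda>k. complex_of_real \<alpha> * c k) + code d (\<lambda>k. \<not> s k) (\<lambda>k. complex_of_real \<beta> * c k))
    = (code d t (\<lambda>k. complex_of_real \<alpha> * c k) + code d t (\<lambda>_. 0))
      + (code d t (\<lambda>_. 0) + code d t (\<lambda>k. complex_of_real \<beta> * c k))"
    unfolding recovery_def
    by (subst apply_kraus_pair[where n = "2 * d"])
       (simp_all add: conj_add[where n = "2 * d"] conj_reset_code)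
  also have "\<dots> = code d t c"
    by (rule eq_matI) (simp_all add: code_index mult_ac *)
  finally show ?thesis .
qed

lemma recovery_channel: "is_channel (2 * d) (recovery d s t)"
proof -
  have R: "mat_adjoint (reset_mat d u t) * reset_mat d u t
      = block_mat d (\<lambda>k q r. yvec (u k) q * cnj (yvec (u k) r))" for u
  proof -
    have "(\<Sum>p<2. cnj (yvec (t k) p * cnj (yvec (u k) q)) * (yvec (t k) p * cnj (yvec (u k) r)))
        = yvec (u k) q * cnj (yvec (u k) r) * (\<Sum>p<2. cnj (yvec (t k) p) * yvec (t k) p)" for k q r
      by (simp add: sum_distrib_left mult_ac)
    thus ?thesis unfolding reset_mat_def adjoint_block_mult_block yvec_orthonormal by simp
  qed
  have "block_mat d (\<lambda>k q r. yvec (s k) q * cnj (yvec (s k) r))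
      + block_mat d (\<lambda>k q r. yvec (\<not> s k) q * cnj (yvec (\<not> s k) r)) = 1\<^sub>m (2 * d)"
  proof (rule eq_matI)
    fix i j assume "i < dim_row (1\<^sub>m (2 * d) :: complex mat)" "j < dim_col (1\<^sub>m (2 * d) :: complex mat)"
    hence ij: "i < 2 * d" "j < 2 * d" by simp_all
    hence "i div d < 2" "j div d < 2" by (simp_all add: less_mult_imp_div_less)
    moreover have "i = j \<longleftrightarrow> i mod d = j mod d \<and> i div d = j div d"
      by (metis div_mult_mod_eq)
    ultimately show "(block_mat d (\<lambda>k q r. yvec (s k) q * cnj (yvec (s k) r))
      + block_mat d (\<lambda>k q r. yvec (\<not> s k) q * cnj (yvec (\<not> s k) r))) $$ (i, j) = 1\<^sub>m (2 * d) $$ (i, j)"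
      using ij yvec_complete[of "i div d" "j div d" "s (j mod d)"]
      by (cases "i mod d = j mod d"; cases "i div d = j div d") (simp_all add: block_mat_def)
  qed simp_all
  thus ?thesis
    by (simp add: is_channel_def recovery_def msum_def R)
qed

definition phase_amp :: "(nat \<Rightarrow> real) \<Rightarrow> real \<Rightarrow> nat \<Rightarrow> nat \<Rightarrow> complex" where
  "phase_amp a \<theta> n k = complex_of_real (a k) * (cis (- real n * \<theta>) * cis (2 * \<theta>) ^ min n k)"

lemma phase_amp_Suc:
  "phase_amp a \<theta> n k * cis (if n < k then \<theta> else - \<theta>) = phase_amp a \<theta> (Suc n) k"
proof (cases "n < k")
  case True
  hence "min (Suc n) k = Suc n" "min n k = n" by auto
  thus ?thesis using True
    by (simp add: phase_amp_def DeMoivre cis_mult mult.assoc algebra_simps)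
next
  case False
  hence "min (Suc n) k = k" "min n k = k" by auto
  thus ?thesis using False
    by (simp add: phase_amp_def DeMoivre cis_mult mult.assoc algebra_simps)
qed

definition recoveries :: "nat \<Rightarrow> nat \<Rightarrow> complex mat list list" where
  "recoveries d n = map (\<lambda>n. recovery d (\<lambda>k. n < k) (\<lambda>k. Suc n < k)) [0..<n]"

lemma run_recoveries:
  assumes "0 \<le> \<eta> \<theta>" "\<eta> \<theta> \<le> 1"
  shows "run \<eta> \<theta> d (code d (\<lambda>k. 0 < k) (\<lambda>k. complex_of_real (a k))) (recoveries d n)
    = code d (\<lambda>k. n < k) (phase_amp a \<theta> n)"
proof (induction n)
  case 0
  show ?case by (simp add: run_def recoveries_def phase_amp_def)
next
  case (Suc n)
  have "run \<eta> \<theta> d (code d (\<lambda>k. 0 < k) (\<lambda>k. complex_of_real (a k))) (recoveries d (Suc n))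
      = apply_kraus (recovery d (\<lambda>k. n < k) (\<lambda>k. Suc n < k))
          (apply_kraus (map (\<lambda>K. kron K (1\<^sub>m d)) (kraus_E \<eta> \<theta>))
            (code d (\<lambda>k. n < k) (phase_amp a \<theta> n)))"
    using Suc.IH by (simp add: run_def recoveries_def)
  also have "\<dots> = apply_kraus (recovery d (\<lambda>k. n < k) (\<lambda>k. Suc n < k))
      (code d (\<lambda>k. n < k) (\<lambda>k. complex_of_real (sqrt (\<eta> \<theta>)) * phase_amp a \<theta> (Suc n) k) +
       code d (\<lambda>k. \<not> n < k) (\<lambda>k. complex_of_real (sqrt (1 - \<eta> \<theta>)) * phase_amp a \<theta> (Suc n) k))"
    unfolding apply_noise_code phase_amp_Suc[symmetric] by (simp only: mult.left_commute)
  also have "\<dots> = code d (\<lambda>k. Suc n < k) (phase_amp a \<theta> (Suc n))"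
    by (rule apply_recovery_code) (use assms in simp)
  finally show ?case .
qed

section \<open>The Fourier measurement\<close>

definition fourier_vec :: "nat \<Rightarrow> nat \<Rightarrow> nat \<Rightarrow> complex" where
  "fourier_vec d i x = (if x div d = i div d
     then cis (2 * pi * real (i mod d) * real (x mod d) / real d) / complex_of_real (sqrt (real d)) else 0)"

definition fourier_povm :: "nat \<Rightarrow> complex mat list" where
  "fourier_povm d = map (\<lambda>i. outer (2 * d) (fourier_vec d i)) [0..<2 * d]"

lemma msum_map:
  assumes "\<And>x. x \<in> set xs \<Longrightarrow> f x \<in> carrier_mat n n"
  shows "msum n (map f xs) \<in> carrier_mat n n"
    and "i < n \<Longrightarrow> j < n \<Longrightarrow> msum n (map f xs) $$ (i, j) = (\<Sum>x\<leftarrow>xs. f x $$ (i, j))"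
proof -
  have "msum n (map f xs) \<in> carrier_mat n n \<and>
      (i < n \<longrightarrow> j < n \<longrightarrow> msum n (map f xs) $$ (i, j) = (\<Sum>x\<leftarrow>xs. f x $$ (i, j)))"
    using assms
  proof (induction xs)
    case (Cons x xs)
    hence "msum n (map f xs) \<in> carrier_mat n n" by simp
    with Cons show ?case by (auto simp: msum_def)
  qed (simp add: msum_def)
  thus "msum n (map f xs) \<in> carrier_mat n n"
    and "i < n \<Longrightarrow> j < n \<Longrightarrow> msum n (map f xs) $$ (i, j) = (\<Sum>x\<leftarrow>xs. f x $$ (i, j))"
    by blast+
qed

lemma fourier_vec_complete:
  assumes "x < 2 * d" "y < 2 * d"
  shows "(\<Sum>i<2 * d. fourier_vec d i x * cnj (fourier_vec d i y)) = (if x = y then 1 else 0)"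
proof -
  have d: "0 < d" using assms by auto
  have F: "fourier_vec d (q * d + m) x * cnj (fourier_vec d (q * d + m) y)
      = (if q = x div d \<and> q = y div d
         then cis (2 * pi * real m * real (x mod d) / real d)
           * cnj (cis (2 * pi * real m * real (y mod d) / real d)) / of_nat d else 0)" if "m < d" for q m
    using that d by (auto simp: fourier_vec_def simp flip: of_real_mult)
  have if_sum: "(\<Sum>m<d. if P then f m / of_nat d else 0) = (if P then (\<Sum>m<d. f m) / of_nat d else 0)"
    for P and f :: "nat \<Rightarrow> complex" by (simp add: sum_divide_distrib)
  have "(\<Sum>i<2 * d. fourier_vec d i x * cnj (fourier_vec d i y))
      = (\<Sum>q<2. if q = x div d then (if x div d = y div d \<and> x mod d = y mod d then 1 else 0) else 0)"
    unfolding sum_two_mult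
  proof (intro sum.cong refl)
    fix q :: nat
    have "(\<Sum>m<d. fourier_vec d (q * d + m) x * cnj (fourier_vec d (q * d + m) y))
        = (\<Sum>m<d. if q = x div d \<and> q = y div d
         then cis (2 * pi * real m * real (x mod d) / real d)
           * cnj (cis (2 * pi * real m * real (y mod d) / real d)) / of_nat d else 0)"
      by (intro sum.cong refl F) simp
    also have "\<dots> = (if q = x div d \<and> q = y div d
         then (\<Sum>m<d. cis (2 * pi * real m * real (x mod d) / real d)
           * cnj (cis (2 * pi * real m * real (y mod d) / real d))) / of_nat d else 0)"
      by (rule if_sum)
    also have "\<dots> = (if q = x div d then (if x div d = y div d \<and> x mod d = y mod d then 1 else 0) else 0)"
      using d by (subst sum_root_of_unity) auto
    finally show "(\<Sum>m<d. fourier_vec d (q * d + m) x * cnj (fourier_vec d (q * d + m) y)) = \<dots>" .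
  qed
  also have "\<dots> = (if x div d = y div d \<and> x mod d = y mod d then 1 else 0)"
    using assms by (simp add: less_mult_imp_div_less)
  also have "\<dots> = (if x = y then 1 else 0)" by (metis div_mult_mod_eq)
  finally show ?thesis .
qed

lemma is_povm_fourier: "is_povm (2 * d) (fourier_povm d)"
  unfolding is_povm_def
proof
  show "\<forall>M\<in>set (fourier_povm d). psd (2 * d) M" by (auto simp: fourier_povm_def psd_outer)
  have "msum (2 * d) (fourier_povm d) $$ (x, y) = 1\<^sub>m (2 * d) $$ (x, y)"
    if "x < 2 * d" "y < 2 * d" for x y
    unfolding fourier_povm_def using that
    by (subst msum_map(2))
       (simp_all add: interv_sum_list_conv_sum_set_nat atLeast0LessThan outer_def fourier_vec_complete)
  moreover have "msum (2 * d) (fourier_povm d) \<in> carrier_mat (2 * d) (2 * d)"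
    unfolding fourier_povm_def by (rule msum_map) simp
  ultimately show "msum (2 * d) (fourier_povm d) = 1\<^sub>m (2 * d)"
    by (intro eq_matI) auto
qed

lemma density_code:
  assumes "(\<Sum>k<d. (cmod (c k))\<^sup>2) = 1"
  shows "density (2 * d) (code d s c)"
proof -
  have "ctrace (code d s c) = complex_of_real (\<Sum>q::nat<2. \<Sum>k<d. (cmod (c k))\<^sup>2 / 2)"
    unfolding code_def ctrace_outer sum_two_mult of_real_sum
    by (intro sum.cong refl) (simp add: norm_mult power_mult_distrib cmod_yvec_sq)
  also have "\<dots> = 1" using assms by (simp flip: sum_divide_distrib)
  finally show ?thesis by (simp add: density_def code_def psd_outer)
qed

lemma fourier_outcome:
  assumes "0 < d"
  shows "(\<Sum>i<2 * d. Re (ctrace (outer (2 * d) (fourier_vec d i) * code d (\<lambda>_. s) c)) * g (i mod d))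
    = (\<Sum>m<d. (cmod (\<Sum>k<d. c k * cis (- (2 * pi * real m * real k / real d))))\<^sup>2 / real d * g m)"
proof -
  define A where "A m = (\<Sum>k<d. c k * cis (- (2 * pi * real m * real k / real d)))" for m
  have "Re (ctrace (outer (2 * d) (fourier_vec d (q * d + m)) * code d (\<lambda>_. s) c))
      = (cmod (A m))\<^sup>2 / real d / 2" if "m < d" "q < 2" for q m
  proof -
    have "(\<Sum>x<2 * d. cnj (fourier_vec d (q * d + m) x) * (c (x mod d) * yvec s (x div d)))
        = (\<Sum>r<2. \<Sum>k<d. if r = q then c k * cis (- (2 * pi * real m * real k / real d))
             * yvec s q / complex_of_real (sqrt (real d)) else 0)"
      unfolding sum_two_mult using that
      by (intro sum.cong refl) (simp add: fourier_vec_def cis_cnj mult_ac)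
    also have "\<dots> = (\<Sum>r<2. if r = q then A m * yvec s q / complex_of_real (sqrt (real d)) else 0)"
      by (intro sum.cong refl) (simp add: A_def sum_distrib_right sum_divide_distrib)
    also have "\<dots> = A m * yvec s q / complex_of_real (sqrt (real d))" using that by simp
    finally show ?thesis
      unfolding code_def ctrace_outer_outer
      by (simp add: norm_mult norm_divide power_mult_distrib power_divide cmod_yvec_sq)
  qed
  hence "(\<Sum>i<2 * d. Re (ctrace (outer (2 * d) (fourier_vec d i) * code d (\<lambda>_. s) c)) * g (i mod d))
      = (\<Sum>q::nat<2. \<Sum>m<d. (cmod (A m))\<^sup>2 / real d / 2 * g m)"
    unfolding sum_two_mult by (intro sum.cong refl) simp
  also have "\<dots> = (\<Sum>m<d. (cmod (A m))\<^sup>2 / real d * g m)"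
    by (simp add: sum_distrib_left)
  finally show ?thesis unfolding A_def .
qed

theorem mainTheorem3:
  fixes \<eta> :: "real \<Rightarrow> real"
  assumes "\<forall>\<theta> \<in> {0..pi/2}. 0 \<le> \<eta> \<theta> \<and> \<eta> \<theta> \<le> 1"
  shows "\<exists>C N0. \<forall>N \<ge> N0. \<exists>d \<rho>0 Vs Ms est. valid_protocol N d \<rho>0 Vs Ms \<and>
           (\<forall>\<theta> \<in> {0..pi/2}. sqrt (mse \<eta> \<theta> d \<rho>0 Vs Ms est) \<le> C * ln (real N) / real N)"
proof (rule exI[where x = "sqrt (sin_const / 4) * pi"], rule exI[where x = 3], intro allI impI)
  fix N :: nat assume N: "3 \<le> N"
  define d where "d = Suc N"
  define s where "s k = sin (real k * (pi / real d))" for k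
  define S where "S = (\<Sum>k<d. (s k)\<^sup>2)"
  define a where "a k = 1 / sqrt S * s k" for k
  define \<rho>0 where "\<rho>0 = code d (\<lambda>k. 0 < k) (\<lambda>k. complex_of_real (a k))"
  define est where "est i = phase_est d (i mod d)" for i
  have d: "d > 0" by (simp add: d_def)
  have "s 1 > 0" unfolding s_def using N by (intro sin_gt_zero) (simp_all add: d_def field_simps)
  hence "0 < (s 1)\<^sup>2" by simp
  also have "\<dots> \<le> S" unfolding S_def using N by (intro member_le_sum) (simp_all add: d_def)
  finally have S: "S > 0" .
  have "(\<Sum>k<d. (a k)\<^sup>2) = S / S"
    using S unfolding a_def power_mult_distrib sum_distrib_left[symmetric] S_def[symmetric]
    by (simp add: power_divide)
  hence norm: "(\<Sum>k<d. (a k)\<^sup>2) = 1" using S by simp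
  have "valid_protocol N d \<rho>0 (recoveries d N) (fourier_povm d)"
    unfolding valid_protocol_def \<rho>0_def
    using d norm is_povm_fourier by (auto simp: recoveries_def recovery_channel intro!: density_code)
  moreover have "sqrt (mse \<eta> \<theta> d \<rho>0 (recoveries d N) (fourier_povm d) est)
      \<le> sqrt (sin_const / 4) * pi * ln (real N) / real N" if "\<theta> \<in> {0..pi/2}" for \<theta>
  proof -
    have "run \<eta> \<theta> d \<rho>0 (recoveries d N) = code d (\<lambda>k. N < k) (phase_amp a \<theta> N)"
      unfolding \<rho>0_def using assms that by (intro run_recoveries) auto
    also have "\<dots> = code d (\<lambda>_. False) (phase_amp a \<theta> N)"
      unfolding code_def
    proof (intro outer_cong)
      fix i have "\<not> N < i mod d" using mod_less_divisor[OF d, of i] unfolding d_def by linarith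
      thus "phase_amp a \<theta> N (i mod d) * yvec (N < i mod d) (i div d)
        = phase_amp a \<theta> N (i mod d) * yvec False (i div d)" by simp
    qed
    finally have "mse \<eta> \<theta> d \<rho>0 (recoveries d N) (fourier_povm d) est
        = (\<Sum>m<d. (cmod (\<Sum>k<d. phase_amp a \<theta> N k * cis (- (2 * pi * real m * real k / real d))))\<^sup>2
            / real d * (phase_est d m - \<theta>)\<^sup>2)"
      using fourier_outcome[OF d, where g = "\<lambda>m. (phase_est d m - \<theta>)\<^sup>2"]
      by (simp add: mse_def fourier_povm_def est_def)
    also have "\<dots> = (\<Sum>m<d. (cmod (\<Sum>k<d. complex_of_real (a k) * cis (2 * \<theta> - 2 * pi * real m / real d) ^ k))\<^sup>2
            / real d * (phase_est d m - \<theta>)\<^sup>2)"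
    proof (intro sum.cong refl)
      fix m
      have "phase_amp a \<theta> N k * cis (- (2 * pi * real m * real k / real d))
          = cis (- real N * \<theta>) * (complex_of_real (a k) * cis (2 * \<theta> - 2 * pi * real m / real d) ^ k)"
        if "k < d" for k
      proof -
        have "min N k = k" using that by (simp add: d_def)
        moreover have "cis (2 * \<theta>) ^ k * cis (- (2 * pi * real m * real k / real d))
            = cis (2 * \<theta> - 2 * pi * real m / real d) ^ k"
          by (simp add: DeMoivre cis_mult algebra_simps)
        ultimately show ?thesis by (simp add: phase_amp_def mult_ac)
      qed
      hence "(\<Sum>k<d. phase_amp a \<theta> N k * cis (- (2 * pi * real m * real k / real d)))
          = cis (- real N * \<theta>) * (\<Sum>k<d. complex_of_real (a k) * cis (2 * \<theta> - 2 * pi * real m / real d) ^ k)"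
        unfolding sum_distrib_left by (intro sum.cong refl) simp
      thus "(cmod (\<Sum>k<d. phase_amp a \<theta> N k * cis (- (2 * pi * real m * real k / real d))))\<^sup>2
            / real d * (phase_est d m - \<theta>)\<^sup>2
          = (cmod (\<Sum>k<d. complex_of_real (a k) * cis (2 * \<theta> - 2 * pi * real m / real d) ^ k))\<^sup>2
            / real d * (phase_est d m - \<theta>)\<^sup>2"
        by (simp add: norm_mult)
    qed
    also have "\<dots> \<le> sin_const / 4 * (pi / real d)\<^sup>2"
      by (rule phase_estimation_error[where c = "1 / sqrt S"])
         (use d norm that in \<open>auto simp: a_def s_def\<close>)
    finally have "sqrt (mse \<eta> \<theta> d \<rho>0 (recoveries d N) (fourier_povm d) est)
        \<le> sqrt (sin_const / 4 * (pi / real d)\<^sup>2)" by (rule real_sqrt_le_mono)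
    also have "\<dots> = sqrt (sin_const / 4) * pi * (1 / real d)"
      unfolding real_sqrt_mult real_sqrt_abs by simp
    also have "\<dots> \<le> sqrt (sin_const / 4) * pi * (ln (real N) / real N)"
    proof (intro mult_left_mono)
      have "exp 1 \<le> real N" using exp_le N by linarith
      hence "1 \<le> ln (real N)" using N by (subst ln_ge_iff) auto
      thus "1 / real d \<le> ln (real N) / real N" using N by (intro frac_le) (auto simp: d_def)
    qed (simp add: sin_const_nonneg)
    finally show ?thesis by simp
  qed
  ultimately show "\<exists>d \<rho>0 Vs Ms est. valid_protocol N d \<rho>0 Vs Ms \<and>
      (\<forall>\<theta> \<in> {0..pi/2}. sqrt (mse \<eta> \<theta> d \<rho>0 Vs Ms est) \<le> sqrt (sin_const / 4) * pi * ln (real N) / real N)"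
    by blast
qed

end
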